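(* Let $\mathcal{G}=(V,\mathcal{E})$ be a connected graph with countable vertex set, endowed with a weight function $a$ that makes it a transient weighted graph. For $u\ge 0$ and $x\in V$ let $\eta(u,x)$ be the probability that the cluster containing $x$ in the vacant set $\mathcal{V}^u$ at level $u$ of random interlacements on $\mathcal{G}$ is infinite. Then the critical point $$u_*=\inf\{u\ge 0;\ \eta(u,x)=0\}\in[0,\infty]$$ is well defined regardless of the choice of the base point $x$, i.e. $\inf\{u\ge0;\eta(u,x)=0\}=\inf\{u\ge0;\eta(u,x')=0\}$ for all $x,x'\in V$.
   Context: Weighted graphs. $\mathcal{G}=(V,\mathcal{E})$ is connected, $V$ is countable and $\mathcal{E}\subset\{\{x,y\}\subset V;\ x\neq y\}$; $x,y$ are neighbors if $\{x,y\}\in\mathcal{E}$. A weight function is a symmetric map $a:V\times V\to\mathbb{R}_+$ with $a_{x,y}>0$ iff $\{x,y\}\in\mathcal{E}$. Put $\mu_x=\sum_{y:\{x,y\}\in\mathcal{E}}a_{x,y}$, assumed finite. The weighted graph is transient if the random walk with transition probabilities $a_{x,y}/\mu_x$ is transient; equivalently, if the capacity of some (every) nonempty finite set is positive. Capacity. For finite $K\subset V$, $\mathrm{cap}(K)=\inf\{\frac12\sum_{x,y\in V}|f(x)-f(y)|^2a_{x,y};\ f:V\to\mathbb{R}\text{ finitely supported},\ f\equiv1\text{ on }K\}$. Random interlacements. With $P_x$ the law of the walk from $x$, $\widetilde H_K=\inf\{n\ge1;X_n\in K\}$ and $e_K(x)=1_{\{x\in K\}}P_x[\widetilde H_K=\infty]\mu_x$,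 one has $\mathrm{cap}(K)=\sum_{x\in K}e_K(x)$. $W_+$ (resp. $W$) is the set of nearest-neighbor trajectories indexed by $\mathbb{N}=\{0,1,\dots\}$ (resp. $\mathbb{Z}$) that visit each vertex only finitely many times, with the $\sigma$-algebra generated by the canonical coordinates $X_n$. $W^*$ is the quotient of $W$ by time shift, with projection $\pi^*$ and the $\sigma$-algebra $\{A;(\pi^* )^{-1}(A)\text{ measurable}\}$; $W_K$ is the set of $w\in W$ entering $K$, and $W_K^*=\pi^*(W_K)$. There is a unique $\sigma$-finite measure $\nu$ on $W^*$ such that for each finite $K\subset V$, $1_{W_K^*}\cdot\nu$ is the image under $\pi^*$ of the measure $Q_K$ on $W_K$ given by $Q_K[(X_{-n})_{n\ge0}\in A,X_0=x,(X_n)_{n\ge0}\in B]=P_x[A\mid\widetilde H_K=\infty]\,e_K(x)\,P_x[B]$ for measurable $A,B\subset W_+$ and $x\in V$. Let $\mathbb{P}$ be the law of a Poisson point process $\omega=\sum_i\delta_{(w_i^*,u_i)}$ on $W^*\times\mathbb{R}_+$ with intensity $\nu(dw^* )\otimes du$. The vacant set at level $u\ge0$ is $\mathcal{V}^u=V\setminus\bigcup_{i:u_i\le u}\mathrm{Range}(w_i^* )$. The law $Q^u$ of $(1_{\{x\in\mathcal{V}^u\}})_{x\in V}$ on $\{0,1\}^V$ (with the $\sigma$-algebra generated by the coordinates $Y_x$) is the unique probability measure such that $Q^u[Y_x=1\text{ for all }x\in K]=\exp(-u\cdot\mathrm{cap}(K))$ for all finite $K\subset V$. The cluster containing $x$ in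 $\mathcal{V}^u$ is the connected component of $x$ in the subgraph of $\mathcal{G}$ induced by $\mathcal{V}^u$ (empty if $x\notin\mathcal{V}^u$), and $\eta(u,x)=\mathbb{P}[\text{the cluster containing }x\text{ in }\mathcal{V}^u\text{ is infinite}]$. By convention $\inf\emptyset=\infty$. *)

theory Defs
  imports "HOL-Probability.Probability"
begin

section \<open>Poisson point processes\<close>

text \<open>A sequence \<open>c\<close> of optional points stands for the point measure that puts a unit mass at \<open>p\<close>
  for every index \<open>i\<close> with \<open>c i = Some p\<close>; repeated points count with multiplicity.\<close>

type_synonym 'p point_config = "nat \<Rightarrow> 'p option"

definition point_count :: "'p point_config \<Rightarrow> 'p set \<Rightarrow> ennreal" where
  "point_count c A = emeasure (count_space UNIV) {i. \<exists>p\<in>A. c i = Some p}"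

definition poisson_point_process :: "'o measure \<Rightarrow> 'p measure \<Rightarrow> ('o \<Rightarrow> 'p point_config) \<Rightarrow> bool" where
  "poisson_point_process M \<Lambda> \<omega> \<longleftrightarrow>
     prob_space M \<and>
     (\<forall>\<xi>\<in>space M. \<forall>i p. \<omega> \<xi> i = Some p \<longrightarrow> p \<in> space \<Lambda>) \<and>
     (\<forall>A\<in>sets \<Lambda>. (\<lambda>\<xi>. point_count (\<omega> \<xi>) A) \<in> borel_measurable M) \<and>
     (\<forall>A\<in>sets \<Lambda>. emeasure \<Lambda> A < \<infinity> \<longrightarrow>
        (\<forall>k::nat. \<P>(\<xi> in M. point_count (\<omega> \<xi>) A = of_nat k)
           = measure \<Lambda> A ^ k / fact k * exp (- measure \<Lambda> A))) \<and>
     (\<forall>A\<in>sets \<Lambda>. emeasure \<Lambda> A = \<infinity> \<longrightarrow> (AE \<xi> in M. point_count (\<omega> \<xi>) A = \<infinity>)) \<and>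
     (\<forall>A :: nat \<Rightarrow> 'p set. (\<forall>j. A j \<in> sets \<Lambda>) \<longrightarrow> disjoint_family A \<longrightarrow>
        prob_space.indep_vars M (\<lambda>_. borel) (\<lambda>j \<xi>. point_count (\<omega> \<xi>) (A j)) UNIV)"

section \<open>Connected weighted graphs\<close>

locale weighted_graph =
  fixes V :: "'v set" and E :: "'v set set" and a :: "'v \<Rightarrow> 'v \<Rightarrow> real"
  assumes countable_V: "countable V"
    and edges: "E \<subseteq> {{x, y} | x y. x \<in> V \<and> y \<in> V \<and> x \<noteq> y}"
    and connected_graph: "\<And>x y. x \<in> V \<Longrightarrow> y \<in> V \<Longrightarrow> (x, y) \<in> {(x', y'). {x', y'} \<in> E}\<^sup>*"
    and a_sym: "\<And>x y. x \<in> V \<Longrightarrow> y \<in> V \<Longrightarrow> a x y = a y x"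
    and a_nonneg: "\<And>x y. x \<in> V \<Longrightarrow> y \<in> V \<Longrightarrow> 0 \<le> a x y"
    and a_pos_iff: "\<And>x y. x \<in> V \<Longrightarrow> y \<in> V \<Longrightarrow> 0 < a x y \<longleftrightarrow> {x, y} \<in> E"
    and a_summable: "\<And>x. x \<in> V \<Longrightarrow> a x summable_on {y. {x, y} \<in> E}"
begin

definition \<mu> :: "'v \<Rightarrow> real" where
  "\<mu> x = (\<Sum>\<^sub>\<infinity>y\<in>{y. {x, y} \<in> E}. a x y)"

subsection \<open>The random walk and transience\<close>

text \<open>\<open>is_walk_law x P\<close> prescribes the probabilities of the cylinder events; by \<open>ex1_walk_law\<close> below,
  this determines the law of the walk started at \<open>x\<close>, unless \<open>x\<close> is the only vertex, in which case
  the transition probabilities \<open>a x y / \<mu> x\<close> make no sense.\<close>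

definition is_walk_law :: "'v \<Rightarrow> (nat \<Rightarrow> 'v) measure \<Rightarrow> bool" where
  "is_walk_law x P \<longleftrightarrow>
     prob_space P \<and> sets P = sets (\<Pi>\<^sub>M n\<in>UNIV. count_space V) \<and>
     (\<forall>n xs. (\<forall>i\<le>n. xs i \<in> V) \<longrightarrow>
        \<P>(X in P. \<forall>i\<le>n. X i = xs i) = (if xs 0 = x then \<Prod>i<n. a (xs i) (xs (Suc i)) / \<mu> (xs i) else 0))"

lemma walk_law_unique:
  assumes P: "is_walk_law x P" and Q: "is_walk_law x Q"
  shows "P = Q"
proof -
  let ?S = "\<Pi>\<^sub>M n\<in>(UNIV::nat set). count_space V"
  have sP: "sets P = sets ?S" and sQ: "sets Q = sets ?S"
    using P Q by (auto simp: is_walk_law_def)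
  interpret P: prob_space P using P by (simp add: is_walk_law_def)
  interpret Q: prob_space Q using Q by (simp add: is_walk_law_def)
  have spP: "space P = UNIV \<rightarrow>\<^sub>E V" and spQ: "space Q = UNIV \<rightarrow>\<^sub>E V"
    using sets_eq_imp_space_eq[OF sP] sets_eq_imp_space_eq[OF sQ] by (auto simp: space_PiM)
  show ?thesis
  proof (rule measure_eqI_PiM_infinite[OF sP sQ])
    show "finite_measure P" by unfold_locales
    fix A :: "nat \<Rightarrow> 'v set" and J :: "nat set"
    assume J: "finite J" and A: "\<And>i. i \<in> J \<Longrightarrow> A i \<in> sets (count_space V)"
    obtain n where n: "J \<subseteq> {..n}"
      using J by (metis finite_nat_iff_bounded_le)
    define L where "L = {xs \<in> {..n} \<rightarrow>\<^sub>E V. \<forall>j\<in>J. xs j \<in> A j}"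
    define C where "C xs = {X \<in> UNIV \<rightarrow>\<^sub>E V. \<forall>i\<le>n. X i = xs i}" for xs :: "nat \<Rightarrow> 'v"
    have cL: "countable L"
      unfolding L_def
      by (rule countable_subset[of _ "{..n} \<rightarrow>\<^sub>E V"]) (auto intro!: countable_PiE countable_V)
    have C: "C xs \<in> sets ?S" if "xs \<in> L" for xs
    proof -
      have "C xs = prod_emb UNIV (\<lambda>_. count_space V) {..n} (Pi\<^sub>E {..n} (\<lambda>i. {xs i}))"
        by (auto simp: C_def prod_emb_def PiE_iff Pi_iff)
      also have "\<dots> \<in> sets ?S"
        using that by (intro sets_PiM_I) (auto simp: L_def PiE_iff)
      finally show ?thesis .
    qed
    have disj: "disjoint_family_on C L"
    proof (unfold disjoint_family_on_def, intro ballI impI)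
      fix xs ys assume "xs \<in> L" "ys \<in> L" "xs \<noteq> ys"
      then obtain i where "xs i \<noteq> ys i" "i \<le> n"
        using PiE_ext[of xs "{..n}" "\<lambda>_. V" ys] by (auto simp: L_def)
      then show "C xs \<inter> C ys = {}" by (auto simp: C_def)
    qed
    have un: "prod_emb UNIV (\<lambda>_. count_space V) J (Pi\<^sub>E J A) = \<Union>(C ` L)" (is "?l = ?r")
    proof (intro equalityI subsetI)
      fix X assume X: "X \<in> ?l"
      then have "restrict X {..n} \<in> L" using n by (auto simp: prod_emb_def L_def PiE_iff)
      moreover have "X \<in> C (restrict X {..n})" using X by (auto simp: prod_emb_def C_def)
      ultimately show "X \<in> ?r" by blast
    next
      fix X assume "X \<in> ?r"
      then show "X \<in> ?l" using n by (auto simp: prod_emb_def C_def L_def PiE_iff)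
    qed
    have eq: "emeasure P (C xs) = emeasure Q (C xs)" if "xs \<in> L" for xs
    proof -
      have "\<forall>i\<le>n. xs i \<in> V" using that by (auto simp: L_def PiE_iff)
      then have "measure P (C xs) = measure Q (C xs)"
        using P Q by (simp add: is_walk_law_def C_def spP spQ)
      then show ?thesis by (simp add: P.emeasure_eq_measure Q.emeasure_eq_measure)
    qed
    show "emeasure P (prod_emb UNIV (\<lambda>_. count_space V) J (Pi\<^sub>E J A))
        = emeasure Q (prod_emb UNIV (\<lambda>_. count_space V) J (Pi\<^sub>E J A))"
      unfolding un using C cL disj eq
      by (simp add: emeasure_UN_countable sP sQ cong: nn_integral_cong_simp)
  qed
qed

lemma \<mu>_pos:
  assumes "x \<in> V" "V \<noteq> {x}"
  shows "0 < \<mu> x"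
proof -
  obtain z where z: "z \<in> V" "z \<noteq> x" using assms by blast
  then have "(x, z) \<in> {(x', y'). {x', y'} \<in> E}\<^sup>*" using connected_graph assms by blast
  then obtain y where y: "{x, y} \<in> E"
    using z by (auto elim: converse_rtranclE)
  have mem: "y \<in> V" if "{x, y} \<in> E" for y using edges that by (auto simp: doubleton_eq_iff)
  have "a x y = (\<Sum>\<^sub>\<infinity>y\<in>{y}. a x y)" by simp
  also have "\<dots> \<le> \<mu> x"
    unfolding \<mu>_def using y a_summable[OF assms(1)] a_nonneg[OF assms(1)] mem
    by (intro infsum_mono_neutral) auto
  finally show ?thesis using a_pos_iff[OF assms(1) mem[OF y]] y by linarith
qed

lemma ex_walk_law:
  assumes x: "x \<in> V" "V \<noteq> {x}"
  shows "\<exists>P. is_walk_law x P"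
proof -
  let ?S = "\<Pi>\<^sub>M n\<in>(UNIV::nat set). count_space V"
  define D where "D y = (if y \<in> V then density (count_space V) (\<lambda>z. ennreal (a y z / \<mu> y))
     else return (count_space V) x)" for y
  have mu: "0 < \<mu> y" if "y \<in> V" for y using \<mu>_pos that x by blast
  have sD [measurable_cong]: "sets (D y) = sets (count_space V)" for y by (simp add: D_def)
  have mem: "z \<in> V" if "{y, z} \<in> E" for y z using edges that by (auto simp: doubleton_eq_iff)
  have pD: "prob_space (D y)" for y
  proof (cases "y \<in> V")
    case True
    have zero: "a y z = 0" if "z \<in> V" "{y, z} \<notin> E" for z
      using a_pos_iff[OF True that(1)] a_nonneg[OF True that(1)] that(2) by linarith
    have hs: "(a y has_sum \<mu> y) {z. {y, z} \<in> E}"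
      unfolding \<mu>_def using a_summable[OF True] by simp
    then have "(a y has_sum \<mu> y) V"
      by (rule has_sum_cong_neutral[THEN iffD1, rotated -1]) (auto simp: zero mem)
    then have hs2: "((\<lambda>z. a y z / \<mu> y) has_sum 1) V"
      using has_sum_cmult_left[where c = "1 / \<mu> y"] mu[OF True] by fastforce
    have "(\<integral>\<^sup>+ z. ennreal (a y z / \<mu> y) \<partial>count_space V) = 1"
    proof -
      have nn: "\<And>z. z \<in> V \<Longrightarrow> 0 \<le> a y z / \<mu> y"
        using a_nonneg[OF True] mu[OF True] by simp
      have "(\<lambda>z. norm (a y z / \<mu> y)) summable_on V"
        by (rule summable_on_cong[THEN iffD2, OF _ has_sum_imp_summable[OF hs2]])
          (unfold real_norm_def, rule abs_of_nonneg, rule nn)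
      then have summ: "Infinite_Set_Sum.abs_summable_on (\<lambda>z. a y z / \<mu> y) V"
        by (rule abs_summable_equivalent[THEN iffD1])
      then show ?thesis
        using nn_integral_conv_infsetsum[OF summ nn] infsetsum_infsum[OF summ] infsumI[OF hs2] by simp
    qed
    then show ?thesis
      using True nn_integral_cong[of "count_space V"
          "\<lambda>z. ennreal (a y z / \<mu> y) * indicator V z"
          "\<lambda>z. ennreal (a y z / \<mu> y)"]
      by (intro prob_spaceI) (simp add: D_def emeasure_density)
  qed (use x in \<open>auto simp: D_def intro!: prob_space_return\<close>)
  have D_single: "emeasure (D y) {z} = ennreal (a y z / \<mu> y)" if "y \<in> V" "z \<in> V" for y z
    using that by (simp add: D_def emeasure_density
        nn_integral_count_space_indicator[symmetric] one_ennreal_def[symmetric])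
  define I where "I = (UNIV :: nat set) \<times> V"
  define R where "R = (\<Pi>\<^sub>M i\<in>I. D (snd i))"
  interpret R: product_prob_space "\<lambda>i. D (snd i)" I
    by (intro product_prob_spaceI pD)
  have pR: "prob_space R" unfolding R_def by (intro prob_space_PiM pD)
  define X where "X f n = rec_nat x (\<lambda>n y. f (n, y)) n" for f :: "nat \<times> 'v \<Rightarrow> 'v" and n
  have X0: "X f 0 = x" and XS: "X f (Suc n) = f (n, X f n)" for f n by (simp_all add: X_def)
  have mX: "(\<lambda>f. X f n) \<in> R \<rightarrow>\<^sub>M count_space V" for n
  proof (induction n)
    case 0
    show ?case using x by (simp add: X0)
  next
    case (Suc n)
    have "(\<lambda>f. (\<lambda>y f. f (n, y)) (X f n) f) \<in> R \<rightarrow>\<^sub>M count_space V"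
    proof (rule measurable_compose_countable'[OF _ Suc countable_V])
      fix y assume "y \<in> V"
      then have "(\<lambda>f. f (n, y)) \<in> R \<rightarrow>\<^sub>M D (snd (n, y))"
        unfolding R_def by (intro measurable_component_singleton) (auto simp: I_def)
      then show "(\<lambda>f. f (n, y)) \<in> R \<rightarrow>\<^sub>M count_space V"
        by (simp add: measurable_cong_sets[OF refl sD])
    qed
    then show ?case by (simp add: XS)
  qed
  have mX': "X \<in> R \<rightarrow>\<^sub>M ?S"
    by (rule measurable_PiM_single') (use mX in \<open>auto simp: measurable_def\<close>)
  define P where "P = distr R ?S X"
  have "is_walk_law x P"
    unfolding is_walk_law_def
  proof (intro conjI allI impI)
    show "prob_space P" unfolding P_def by (intro prob_space.prob_space_distr pR mX')
    show "sets P = sets ?S" by (simp add: P_def)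
    fix n and xs :: "nat \<Rightarrow> 'v" assume xs: "\<forall>i\<le>n. xs i \<in> V"
    have "{X \<in> space ?S. \<forall>i\<le>n. X i = xs i}
        = prod_emb UNIV (\<lambda>_. count_space V) {..n} (Pi\<^sub>E {..n} (\<lambda>i. {xs i}))"
      by (auto simp: prod_emb_def PiE_iff space_PiM)
    also have "\<dots> \<in> sets ?S"
      using xs by (intro sets_PiM_I) auto
    finally have cyl: "{X \<in> space ?S. \<forall>i\<le>n. X i = xs i} \<in> sets ?S" .
    have "measure P {X \<in> space P. \<forall>i\<le>n. X i = xs i}
        = measure R (X -` {X \<in> space ?S. \<forall>i\<le>n. X i = xs i} \<inter> space R)"
      using measure_distr[OF mX' cyl] by (simp add: P_def)
    also have "X -` {X \<in> space ?S. \<forall>i\<le>n. X i = xs i} \<inter> space R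
        = {f \<in> space R. \<forall>i\<le>n. X f i = xs i}"
      using measurable_space[OF mX'] by auto
    also have "\<dots> = {f \<in> space R. xs 0 = x \<and> (\<forall>i\<in>(\<lambda>i. (i, xs i)) ` {..<n}. f i \<in> {xs (Suc (fst i))})}"
    proof -
      have "(\<forall>i\<le>n. X f i = xs i) \<longleftrightarrow> xs 0 = x \<and> (\<forall>i<n. f (i, xs i) = xs (Suc i))" for f
        by (induction n) (auto simp: X0 XS le_Suc_eq less_Suc_eq)
      then show ?thesis by auto
    qed
    also have "measure R \<dots> = (if xs 0 = x then \<Prod>i<n. a (xs i) (xs (Suc i)) / \<mu> (xs i) else 0)"
    proof (cases "xs 0 = x")
      case True
      have "emeasure R {f \<in> space R. \<forall>i\<in>(\<lambda>i. (i, xs i)) ` {..<n}. f i \<in> {xs (Suc (fst i))}}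
          = (\<Prod>i\<in>(\<lambda>i. (i, xs i)) ` {..<n}. emeasure (D (snd i)) {xs (Suc (fst i))})"
        unfolding R_def using xs by (intro R.emeasure_PiM_Collect) (auto simp: I_def sD)
      also have "\<dots> = (\<Prod>i<n. emeasure (D (xs i)) {xs (Suc i)})"
        by (subst prod.reindex) (auto simp: inj_on_def)
      also have "\<dots> = (\<Prod>i<n. ennreal (a (xs i) (xs (Suc i)) / \<mu> (xs i)))"
        using xs by (intro prod.cong) (auto simp: D_single)
      also have "\<dots> = ennreal (\<Prod>i<n. a (xs i) (xs (Suc i)) / \<mu> (xs i))"
        using xs mu by (intro prod_ennreal) (auto intro!: divide_nonneg_pos a_nonneg)
      moreover have "0 \<le> (\<Prod>i<n. a (xs i) (xs (Suc i)) / \<mu> (xs i))"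
        using xs mu by (intro prod_nonneg) (auto intro!: divide_nonneg_pos a_nonneg)
      ultimately show ?thesis using True by (simp add: measure_def)
    qed simp
    finally show "\<P>(X in P. \<forall>i\<le>n. X i = xs i)
        = (if xs 0 = x then \<Prod>i<n. a (xs i) (xs (Suc i)) / \<mu> (xs i) else 0)" .
  qed
  then show ?thesis ..
qed

lemma ex1_walk_law: "x \<in> V \<Longrightarrow> V \<noteq> {x} \<Longrightarrow> \<exists>!P. is_walk_law x P"
  using ex_walk_law walk_law_unique by blast

definition walk_law :: "'v \<Rightarrow> (nat \<Rightarrow> 'v) measure" where
  "walk_law x = (THE P. is_walk_law x P)"

definition hit_time :: "'v set \<Rightarrow> (nat \<Rightarrow> 'v) \<Rightarrow> enat" where
  "hit_time K X = Inf {enat n | n. 1 \<le> n \<and> X n \<in> K}"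

definition transient :: bool where
  "transient \<longleftrightarrow> (\<forall>x\<in>V. \<P>(X in walk_law x. hit_time {x} X = \<infinity>) > 0)"

definition equilibrium :: "'v set \<Rightarrow> 'v \<Rightarrow> real" where
  "equilibrium K x = (if x \<in> K then \<P>(X in walk_law x. hit_time K X = \<infinity>) * \<mu> x else 0)"

subsection \<open>Trajectory spaces\<close>

definition Wp :: "(nat \<Rightarrow> 'v) set" where
  "Wp = {X. (\<forall>n. {X n, X (Suc n)} \<in> E) \<and> (\<forall>x\<in>V. finite {n. X n = x})}"

definition Wp_measurable :: "(nat \<Rightarrow> 'v) set set" where
  "Wp_measurable = sets (restrict_space (\<Pi>\<^sub>M n\<in>UNIV. count_space V) Wp)"

definition W :: "(int \<Rightarrow> 'v) set" where
  "W = {w. (\<forall>n. {w n, w (n + 1)} \<in> E) \<and> (\<forall>x\<in>V. finite {n. w n = x})}"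

text \<open>Only the \<open>\<sigma>\<close>-algebras of the measures \<open>W_space\<close> and \<open>W_star_space\<close> are relevant.\<close>

definition W_space :: "(int \<Rightarrow> 'v) measure" where
  "W_space = restrict_space (\<Pi>\<^sub>M n\<in>UNIV. count_space V) W"

definition shift_rel :: "((int \<Rightarrow> 'v) \<times> (int \<Rightarrow> 'v)) set" where
  "shift_rel = {(w, w'). w \<in> W \<and> w' \<in> W \<and> (\<exists>k. \<forall>n. w' n = w (n + k))}"

definition W_star :: "(int \<Rightarrow> 'v) set set" where
  "W_star = W // shift_rel"

definition proj_star :: "(int \<Rightarrow> 'v) \<Rightarrow> (int \<Rightarrow> 'v) set" where
  "proj_star w = shift_rel `` {w}"

definition W_star_space :: "(int \<Rightarrow> 'v) set measure" where
  "W_star_space = sigma W_star {A. A \<subseteq> W_star \<and> {w \<in> W. proj_star w \<in> A} \<in> sets W_space}"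

definition W_hit :: "'v set \<Rightarrow> (int \<Rightarrow> 'v) set" where
  "W_hit K = {w \<in> W. \<exists>n. w n \<in> K}"

definition W_star_hit :: "'v set \<Rightarrow> (int \<Rightarrow> 'v) set set" where
  "W_star_hit K = proj_star ` W_hit K"

subsection \<open>The intensity measure of random interlacements\<close>

definition is_Q :: "'v set \<Rightarrow> (int \<Rightarrow> 'v) measure \<Rightarrow> bool" where
  "is_Q K Q \<longleftrightarrow>
     space Q = W_hit K \<and> sets Q = sets (restrict_space W_space (W_hit K)) \<and>
     (\<forall>A\<in>Wp_measurable. \<forall>B\<in>Wp_measurable. \<forall>x\<in>V.
        emeasure Q {w \<in> W_hit K. (\<lambda>n. w (- int n)) \<in> A \<and> w 0 = x \<and> (\<lambda>n. w (int n)) \<in> B}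
        = ennreal (cond_prob (walk_law x) (\<lambda>X. X \<in> A) (\<lambda>X. hit_time K X = \<infinity>)
                   * equilibrium K x * \<P>(X in walk_law x. X \<in> B)))"

definition interlacement_intensity :: "(int \<Rightarrow> 'v) set measure \<Rightarrow> bool" where
  "interlacement_intensity \<nu> \<longleftrightarrow>
     space \<nu> = W_star \<and> sets \<nu> = sets W_star_space \<and> sigma_finite_measure \<nu> \<and>
     (\<forall>K. finite K \<longrightarrow> K \<subseteq> V \<longrightarrow>
        (\<exists>Q. is_Q K Q \<and> density \<nu> (indicator (W_star_hit K)) = distr Q W_star_space proj_star))"

subsection \<open>Vacant set, percolation probability and critical point\<close>

definition range_star :: "(int \<Rightarrow> 'v) set \<Rightarrow> 'v set" where
  "range_star w' = (\<Union>w\<in>w'. range w)"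

definition vacant :: "((int \<Rightarrow> 'v) set \<times> real) point_config \<Rightarrow> real \<Rightarrow> 'v set" where
  "vacant c u = V - \<Union>{range_star w' | w' i s. c i = Some (w', s) \<and> s \<le> u}"

definition cluster :: "'v set \<Rightarrow> 'v \<Rightarrow> 'v set" where
  "cluster S x =
     (if x \<in> S then {y. (x, y) \<in> {(y, z). y \<in> S \<and> z \<in> S \<and> {y, z} \<in> E}\<^sup>*} else {})"

definition \<eta> :: "'o measure \<Rightarrow> ('o \<Rightarrow> ((int \<Rightarrow> 'v) set \<times> real) point_config) \<Rightarrow> real \<Rightarrow> 'v \<Rightarrow> real" where
  "\<eta> M \<omega> u x = \<P>(\<xi> in M. infinite (cluster (vacant (\<omega> \<xi>) u) x))"

definition u_star :: "'o measure \<Rightarrow> ('o \<Rightarrow> ((int \<Rightarrow> 'v) set \<times> real) point_config) \<Rightarrow> 'v \<Rightarrow> ennreal" where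
  "u_star M \<omega> x = Inf {ennreal u | u. 0 \<le> u \<and> \<eta> M \<omega> u x = 0}"

end

end

theory Submission
  imports Defs
begin

text \<open>
  Whether \<open>\<eta>(u,x)\<close> vanishes does not depend on \<open>x\<close>, for every fixed \<open>u \<ge> 0\<close>; hence neither does the
  infimum. Given \<open>x\<close> and \<open>x'\<close>, let \<open>K\<close> be the vertex set of a finite path between them. If \<open>K\<close> is
  vacant, then \<open>x\<close> and \<open>x'\<close> lie in the same cluster, so it suffices to show that
  \<open>P[K \<subseteq> \<V>\<^sup>u] * \<eta>(u,x') \<le> P[K \<subseteq> \<V>\<^sup>u, the cluster of x' is infinite]\<close>
  and that the first factor is positive.

  The inequality is an instance of positive association (the FKG inequality), but because one of the
  two increasing events is of the form ``\<open>K\<close> is vacant'', independence in the Poisson process is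
  enough. Let \<open>\<V>\<^sub>K\<^sup>u\<close> be the set of vertices that are not visited by any trajectory of label at most
  \<open>u\<close> which avoids \<open>K\<close> (\<open>vacant_avoiding\<close>). It contains \<open>\<V>\<^sup>u\<close>, it equals \<open>\<V>\<^sup>u\<close> when \<open>K\<close> is vacant,
  and it is independent of the event that \<open>K\<close> is vacant, since the former depends on the trajectories
  avoiding \<open>K\<close> and the latter on those hitting \<open>K\<close> (\<open>vacant_indep_vacant_avoiding\<close>). For an
  increasing event \<open>U\<close>, therefore,
  \<open>P[K \<subseteq> \<V>\<^sup>u, \<V>\<^sup>u \<in> U] = P[K \<subseteq> \<V>\<^sup>u, \<V>\<^sub>K\<^sup>u \<in> U] = P[K \<subseteq> \<V>\<^sup>u] * P[\<V>\<^sub>K\<^sup>u \<in> U] \<ge> P[K \<subseteq> \<V>\<^sup>u] * P[\<V>\<^sup>u \<in> U]\<close>,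
  which is \<open>vacant_positive_correlation\<close>.

  The probability that \<open>K\<close> is vacant is \<open>exp (- u * \<nu>(W\<^sub>K\<^sup>*))\<close>. It is positive (\<open>prob_vacant_pos\<close>)
  because \<open>\<nu>(W\<^sub>K\<^sup>*)\<close> is the total mass of \<open>Q\<^sub>K\<close>, a sum of finitely many finite terms indexed by \<open>K\<close>
  (\<open>is_Q_finite\<close>).
\<close>

section \<open>Clusters and increasing events\<close>

context weighted_graph
begin

lemma edge_in_V:
  assumes "{y, z} \<in> E"
  shows "y \<in> V" "z \<in> V"
  using assms edges by (auto simp: doubleton_eq_iff)

definition open_edges :: "'v set \<Rightarrow> ('v \<times> 'v) set" where
  "open_edges S = {(y, z). y \<in> S \<and> z \<in> S \<and> {y, z} \<in> E}"

lemma open_edges_mono: "S \<subseteq> T \<Longrightarrow> open_edges S \<subseteq> open_edges T"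
  by (auto simp: open_edges_def)

lemma cluster_eq: "cluster S x = (if x \<in> S then (open_edges S)\<^sup>* `` {x} else {})"
  by (auto simp: cluster_def open_edges_def)

lemma cluster_mono: "S \<subseteq> T \<Longrightarrow> cluster S x \<subseteq> cluster T x"
  using rtrancl_mono[OF open_edges_mono] by (auto simp: cluster_eq)

lemma cluster_subset: "cluster S x \<subseteq> S"
proof
  fix y assume y: "y \<in> cluster S x"
  then have "(x, y) \<in> (open_edges S)\<^sup>*" "x \<in> S" by (auto simp: cluster_eq split: if_splits)
  then show "y \<in> S" by (induction rule: rtrancl_induct) (auto simp: open_edges_def)
qed

text \<open>The vertices of a path from \<open>x\<close> to \<open>y\<close> form such a set. Finiteness is what later gives the
  event that \<open>K\<close> is vacant a positive probability.\<close>

lemma ex_finite_connecting_set: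
  assumes "x \<in> V" "y \<in> V"
  shows "\<exists>K. finite K \<and> K \<subseteq> V \<and> x \<in> K \<and> (x, y) \<in> (open_edges K)\<^sup>*"
proof -
  have "(x, y) \<in> {(x', y'). {x', y'} \<in> E}\<^sup>*" using connected_graph assms by blast
  then show ?thesis
  proof (induction rule: rtrancl_induct)
    case base
    show ?case using assms by (intro exI[of _ "{x}"]) auto
  next
    case (step y z)
    then obtain K where K: "finite K" "K \<subseteq> V" "x \<in> K" "(x, y) \<in> (open_edges K)\<^sup>*" by blast
    let ?L = "insert y (insert z K)"
    have "(x, y) \<in> (open_edges ?L)\<^sup>*"
      using K(4) rtrancl_mono[OF open_edges_mono[of K ?L]] by blast
    moreover have "(y, z) \<in> open_edges ?L" using step(2) by (simp add: open_edges_def)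
    ultimately have "(x, z) \<in> (open_edges ?L)\<^sup>*" by (rule rtrancl_into_rtrancl)
    moreover have "y \<in> V" "z \<in> V" using step(2) edge_in_V by auto
    ultimately show ?case using K by (intro exI[of _ ?L]) auto
  qed
qed

lemma cluster_eq_of_connecting_set:
  assumes "x \<in> K" "(x, y) \<in> (open_edges K)\<^sup>*" "K \<subseteq> S"
  shows "cluster S y = cluster S x"
proof -
  have xy: "(x, y) \<in> (open_edges S)\<^sup>*"
    using assms rtrancl_mono[OF open_edges_mono] by blast
  have "sym (open_edges S)" by (auto simp: sym_def open_edges_def insert_commute)
  then have yx: "(y, x) \<in> (open_edges S)\<^sup>*"
    using xy by (meson sym_rtrancl symD)
  have "x \<in> S" using assms by blast
  moreover have "y \<in> S"
    using cluster_subset[of S x] xy \<open>x \<in> S\<close> by (auto simp: cluster_eq)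
  ultimately show ?thesis
    using xy yx by (auto simp: cluster_eq intro: rtrancl_trans)
qed

text \<open>The generators are closed under intersection, because \<open>F\<close> ranges over all finite sets and not
  only over singletons. This is what makes independence extend from them to all of \<open>vertex_sets\<close>.\<close>

definition vertex_sets_gen :: "'v set set set" where
  "vertex_sets_gen = {{T. F \<subseteq> T \<and> T \<subseteq> V} | F. finite F \<and> F \<subseteq> V}"

definition vertex_sets :: "'v set measure" where
  "vertex_sets = sigma (Pow V) vertex_sets_gen"

lemma space_vertex_sets [simp]: "space vertex_sets = Pow V"
  unfolding vertex_sets_def by (rule space_measure_of) (auto simp: vertex_sets_gen_def)

lemma sets_vertex_sets: "sets vertex_sets = sigma_sets (Pow V) vertex_sets_gen"
  unfolding vertex_sets_def by (rule sets_measure_of) (auto simp: vertex_sets_gen_def)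

lemma pred_mem_vertex_sets: "Measurable.pred vertex_sets (\<lambda>T. y \<in> T)"
proof (cases "y \<in> V")
  case True
  have "{T. {y} \<subseteq> T \<and> T \<subseteq> V} \<in> sets vertex_sets"
    unfolding sets_vertex_sets vertex_sets_gen_def using True by (intro sigma_sets.Basic) blast
  also have "{T. {y} \<subseteq> T \<and> T \<subseteq> V} = {T \<in> space vertex_sets. y \<in> T}" by auto
  finally show ?thesis by (simp add: pred_def)
next
  case False
  then have "{T \<in> space vertex_sets. y \<in> T} = {}" by auto
  then show ?thesis unfolding pred_def by (simp only: sets.empty_sets)
qed

text \<open>The graph need not be locally finite, so the cluster is not explored in balls. Its infinity is
  instead written with countable operations in two steps: a vertex is in the cluster iff it is
  reached in \<open>n\<close> steps for some \<open>n\<close>, and a set is infinite iff it leaves every finite set.\<close>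

lemma infinite_cluster_measurable:
  "{T \<in> Pow V. infinite (cluster T x)} \<in> sets vertex_sets"
proof -
  note [measurable] = pred_mem_vertex_sets
  have step: "Measurable.pred vertex_sets (\<lambda>T. (x, y) \<in> open_edges T ^^ n)" for n y
  proof (induction n arbitrary: y)
    case 0
    show ?case by simp
  next
    case (Suc n)
    note Suc[measurable]
    have "(\<lambda>T. (x, y) \<in> open_edges T ^^ Suc n)
        = (\<lambda>T. \<exists>z\<in>V. (x, z) \<in> open_edges T ^^ n \<and> z \<in> T \<and> y \<in> T \<and> {z, y} \<in> E)"
      using edge_in_V by (fastforce simp: open_edges_def relcomp_unfold)
    moreover have "Measurable.pred vertex_sets
        (\<lambda>T. \<exists>z\<in>V. (x, z) \<in> open_edges T ^^ n \<and> z \<in> T \<and> y \<in> T \<and> {z, y} \<in> E)"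
      using countable_V by measurable
    ultimately show ?case by simp
  qed
  have mem: "y \<in> cluster T x \<longleftrightarrow> x \<in> T \<and> (\<exists>n. (x, y) \<in> open_edges T ^^ n)" for T y
    by (simp add: cluster_eq rtrancl_power)
  have [measurable]: "Measurable.pred vertex_sets (\<lambda>T. y \<in> cluster T x)" for y
    unfolding mem using step by measurable
  let ?Fin = "{F. finite F \<and> F \<subseteq> V}"
  have cFin: "countable ?Fin" by (rule countable_Collect_finite_subset[OF countable_V])
  have inf: "infinite S \<longleftrightarrow> (\<forall>F\<in>?Fin. \<exists>y\<in>V. y \<notin> F \<and> y \<in> S)" if "S \<subseteq> V" for S
  proof
    assume "infinite S"
    then show "\<forall>F\<in>?Fin. \<exists>y\<in>V. y \<notin> F \<and> y \<in> S"
      using that by (metis (mono_tags, lifting) finite_subset mem_Collect_eq subset_iff)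
  qed (use that in blast)
  have "infinite (cluster T x) \<longleftrightarrow> (\<forall>F\<in>?Fin. \<exists>y\<in>V. y \<notin> F \<and> y \<in> cluster T x)" if "T \<in> Pow V" for T
    by (rule inf) (use cluster_subset[of T x] that in blast)
  then have "{T \<in> Pow V. infinite (cluster T x)}
      = {T \<in> space vertex_sets. \<forall>F\<in>?Fin. \<exists>y\<in>V. y \<notin> F \<and> y \<in> cluster T x}"
    unfolding space_vertex_sets by (intro Collect_cong conj_cong refl)
  also have "\<dots> \<in> sets vertex_sets"
    using countable_V cFin by measurable
  finally show ?thesis .
qed

section \<open>Trajectories hitting a finite set\<close>

lemma equiv_shift_rel: "equiv W shift_rel"
proof (rule equivI)
  show "shift_rel \<subseteq> W \<times> W" by (auto simp: shift_rel_def)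
  show "refl_on W shift_rel"
    by (auto simp: refl_on_def shift_rel_def intro: exI[of _ 0])
  show "sym shift_rel"
  proof (rule symI)
    fix w w' assume "(w, w') \<in> shift_rel"
    then obtain k where "w \<in> W" "w' \<in> W" "\<forall>n. w' n = w (n + k)" by (auto simp: shift_rel_def)
    then show "(w', w) \<in> shift_rel"
      by (auto simp: shift_rel_def intro!: exI[of _ "- k"])
  qed
  show "trans shift_rel"
  proof (rule transI)
    fix w w' w'' assume "(w, w') \<in> shift_rel" "(w', w'') \<in> shift_rel"
    then have W: "w \<in> W" "w'' \<in> W" by (auto simp: shift_rel_def)
    obtain k where k: "\<forall>n. w' n = w (n + k)"
      using \<open>(w, w') \<in> shift_rel\<close> by (auto simp: shift_rel_def)
    obtain l where l: "\<forall>n. w'' n = w' (n + l)"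
      using \<open>(w', w'') \<in> shift_rel\<close> by (auto simp: shift_rel_def)
    have "w'' n = w (n + (l + k))" for n using k l by (simp add: add.assoc)
    then show "(w, w'') \<in> shift_rel" using W by (auto simp: shift_rel_def)
  qed
qed

lemma W_star_hit_subset: "W_star_hit K \<subseteq> W_star"
  by (auto simp: W_star_hit_def W_hit_def proj_star_def W_star_def intro: quotientI)

lemma W_star_hit_iff:
  assumes w': "w' \<in> W_star"
  shows "w' \<in> W_star_hit K \<longleftrightarrow> range_star w' \<inter> K \<noteq> {}"
proof
  assume "w' \<in> W_star_hit K"
  then obtain w n where w: "w \<in> W" "w n \<in> K" "w' = proj_star w"
    by (auto simp: W_star_hit_def W_hit_def)
  then have "w \<in> w'" using equiv_class_self[OF equiv_shift_rel] by (simp add: proj_star_def)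
  then show "range_star w' \<inter> K \<noteq> {}" using w by (auto simp: range_star_def)
next
  assume "range_star w' \<inter> K \<noteq> {}"
  then obtain w n where w: "w \<in> w'" "w n \<in> K" by (auto simp: range_star_def)
  then have "w \<in> W"
    using w' in_quotient_imp_subset[OF equiv_shift_rel] by (auto simp: W_star_def)
  moreover have "w' = proj_star w"
  proof -
    obtain v where "w' = shift_rel `` {v}" using w' by (auto simp: W_star_def elim: quotientE)
    then show ?thesis
      using w(1) equiv_class_eq[OF equiv_shift_rel, of v w] by (auto simp: proj_star_def)
  qed
  ultimately show "w' \<in> W_star_hit K" using w by (auto simp: W_star_hit_def W_hit_def)
qed

lemma W_star_hit_empty [simp]: "W_star_hit {} = {}"
  by (simp add: W_star_hit_def W_hit_def)

lemma space_W_space: "space W_space = W"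
proof -
  have "W \<subseteq> UNIV \<rightarrow>\<^sub>E V"
    using edge_in_V by (fastforce simp: W_def PiE_UNIV_domain)
  then show ?thesis by (auto simp: W_space_def space_restrict_space space_PiM)
qed

lemma coordinate_measurable: "(\<lambda>w. w n) \<in> W_space \<rightarrow>\<^sub>M count_space V"
  unfolding W_space_def by (intro measurable_restrict_space1 measurable_component_singleton) auto

lemma W_hit_measurable:
  assumes "K \<subseteq> V"
  shows "W_hit K \<in> sets W_space"
proof -
  have "W_hit K = (\<Union>n. (\<lambda>w. w n) -` K \<inter> space W_space)"
    by (auto simp: W_hit_def space_W_space)
  also have "\<dots> \<in> sets W_space"
  proof -
    have "(\<lambda>w. w n) -` K \<inter> space W_space \<in> sets W_space" for n
      by (rule measurable_sets[OF coordinate_measurable]) (use assms in simp)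
    then show ?thesis by (intro sets.countable_UN) blast
  qed
  finally show ?thesis .
qed

text \<open>\<open>W_star_space\<close> carries the final \<open>\<sigma>\<close>-algebra of the projection; as \<open>W_hit K\<close> is invariant under
  shifts, it is the full preimage of \<open>W_star_hit K\<close>.\<close>

lemma W_star_hit_measurable:
  assumes "K \<subseteq> V"
  shows "W_star_hit K \<in> sets W_star_space"
proof -
  have "{w \<in> W. proj_star w \<in> W_star_hit K} = W_hit K"
  proof (intro equalityI subsetI)
    fix w assume w: "w \<in> {w \<in> W. proj_star w \<in> W_star_hit K}"
    then obtain v n where v: "v \<in> W" "v n \<in> K" "proj_star w = proj_star v"
      by (auto simp: W_star_hit_def W_hit_def)
    then have "(v, w) \<in> shift_rel"
      using w eq_equiv_class[OF _ equiv_shift_rel, of v w] by (auto simp: proj_star_def)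
    then obtain k where "\<forall>n. w n = v (n + k)" by (auto simp: shift_rel_def)
    then have "w (n - k) \<in> K" using v by simp
    then show "w \<in> W_hit K" using w by (auto simp: W_hit_def)
  qed (auto simp: W_star_hit_def W_hit_def)
  then have "W_star_hit K \<in> {A. A \<subseteq> W_star \<and> {w \<in> W. proj_star w \<in> A} \<in> sets W_space}"
    using W_hit_measurable[OF assms] W_star_hit_subset by simp
  then show ?thesis
    unfolding W_star_space_def by (subst sets_measure_of) (auto intro: sigma_sets.Basic)
qed

lemma Wp_in_Wp_measurable: "Wp \<in> Wp_measurable"
proof -
  have "Wp \<subseteq> UNIV \<rightarrow>\<^sub>E V"
    using edge_in_V by (fastforce simp: Wp_def PiE_UNIV_domain)
  then have "space (restrict_space (\<Pi>\<^sub>M n\<in>(UNIV::nat set). count_space V) Wp) = Wp"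
    by (auto simp: space_restrict_space space_PiM)
  then show ?thesis unfolding Wp_measurable_def by (metis sets.top)
qed

text \<open>Both halves of a trajectory in \<open>W\<close> lie in \<open>W\<^sub>+\<close>, so the formula for \<open>Q\<^sub>K\<close> with \<open>A = B = W\<^sub>+\<close> covers
  all of \<open>W\<^sub>K\<close>: the mass of \<open>Q\<^sub>K\<close> splits according to the position at time \<open>0\<close>, and only
  positions in \<open>K\<close> contribute.\<close>

lemma is_Q_finite:
  assumes Q: "is_Q K Q" and K: "finite K" "K \<subseteq> V"
  shows "emeasure Q (W_hit K) < \<infinity>"
proof -
  have sQ: "space Q = W_hit K" "sets Q = sets (restrict_space W_space (W_hit K))"
    using Q by (auto simp: is_Q_def)
  define S where "S x = {w \<in> W_hit K. w 0 = x}" for x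
  have half: "(\<lambda>n. w (int n)) \<in> Wp" "(\<lambda>n. w (- int n)) \<in> Wp" if "w \<in> W" for w
  proof -
    have e: "{w n, w (n + 1)} \<in> E" for n using that by (simp add: W_def)
    have f: "finite {n. w n = x}" if "x \<in> V" for x using that \<open>w \<in> W\<close> by (simp add: W_def)
    have "finite {n. w (int n) = x}" "finite {n. w (- int n) = x}" if "x \<in> V" for x
    proof -
      show "finite {n. w (int n) = x}"
        using finite_vimageI[OF f[OF that], of int] by (simp add: vimage_def inj_on_def)
      show "finite {n. w (- int n) = x}"
        using finite_vimageI[OF f[OF that], of "\<lambda>n. - int n"] by (simp add: vimage_def inj_on_def)
    qed
    moreover have "{w (int n), w (int (Suc n))} \<in> E" for n
      using e[of "int n"] by (simp add: add.commute)
    moreover have "{w (- int n), w (- int (Suc n))} \<in> E" for n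
      using e[of "- int (Suc n)"] by (simp add: insert_commute)
    ultimately show "(\<lambda>n. w (int n)) \<in> Wp" "(\<lambda>n. w (- int n)) \<in> Wp"
      by (auto simp: Wp_def)
  qed
  have eS: "emeasure Q (S x) = ennreal (cond_prob (walk_law x) (\<lambda>X. X \<in> Wp) (\<lambda>X. hit_time K X = \<infinity>)
      * equilibrium K x * \<P>(X in walk_law x. X \<in> Wp))" if "x \<in> V" for x
  proof -
    have "S x = {w \<in> W_hit K. (\<lambda>n. w (- int n)) \<in> Wp \<and> w 0 = x \<and> (\<lambda>n. w (int n)) \<in> Wp}"
      using half by (auto simp: S_def W_hit_def)
    then show ?thesis
      using Q Wp_in_Wp_measurable that by (simp add: is_Q_def)
  qed
  have S: "S x \<in> sets Q" if "x \<in> V" for x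
  proof -
    have "(\<lambda>w. w 0) -` {x} \<inter> space W_space \<in> sets W_space"
      using that by (intro measurable_sets[OF coordinate_measurable]) auto
    moreover have "S x = W_hit K \<inter> ((\<lambda>w. w 0) -` {x} \<inter> space W_space)"
      by (auto simp: S_def W_hit_def space_W_space)
    ultimately show ?thesis unfolding sQ(2) sets_restrict_space by blast
  qed
  have "W_hit K = (\<Union>x\<in>V. S x)"
  proof -
    have "w 0 \<in> V" if "w \<in> W" for w using that edge_in_V(1)[of "w 0" "w (0 + 1)"] by (simp only: W_def) blast
    then show ?thesis by (auto simp: S_def W_hit_def)
  qed
  moreover have "disjoint_family_on S V" by (auto simp: disjoint_family_on_def S_def)
  ultimately have "emeasure Q (W_hit K) = (\<integral>\<^sup>+x. emeasure Q (S x) \<partial>count_space V)"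
    using emeasure_UN_countable[OF S countable_V] by simp
  also have "\<dots> = (\<integral>\<^sup>+x. emeasure Q (S x) * indicator K x \<partial>count_space V)"
    by (intro nn_integral_cong) (auto simp: eS equilibrium_def indicator_def)
  also have "\<dots> = (\<Sum>x\<in>K. emeasure Q (S x))"
    using K by (subst nn_integral_count_space'[of K]) (auto simp: indicator_def)
  also have "\<dots> < \<infinity>"
    using K eS by (auto simp: less_top[symmetric] subset_iff)
  finally show ?thesis .
qed

lemma proj_star_measurable: "proj_star \<in> W_space \<rightarrow>\<^sub>M W_star_space"
  unfolding W_star_space_def
proof (rule measurable_measure_of)
  show "proj_star \<in> space W_space \<rightarrow> W_star"
    by (auto simp: space_W_space proj_star_def W_star_def intro: quotientI)
  fix A assume "A \<in> {A. A \<subseteq> W_star \<and> {w \<in> W. proj_star w \<in> A} \<in> sets W_space}"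
  moreover have "proj_star -` A \<inter> space W_space = {w \<in> W. proj_star w \<in> A}"
    by (auto simp: space_W_space)
  ultimately show "proj_star -` A \<inter> space W_space \<in> sets W_space" by simp
qed auto

lemma intensity_hit_finite:
  assumes \<nu>: "interlacement_intensity \<nu>" and K: "finite K" "K \<subseteq> V"
  shows "emeasure \<nu> (W_star_hit K) < \<infinity>"
proof -
  obtain Q where Q: "is_Q K Q" "density \<nu> (indicator (W_star_hit K)) = distr Q W_star_space proj_star"
    using \<nu> K unfolding interlacement_intensity_def by blast
  have sQ: "sets Q = sets (restrict_space W_space (W_hit K))" "space Q = W_hit K"
    using Q(1) by (auto simp: is_Q_def)
  have meas: "proj_star \<in> Q \<rightarrow>\<^sub>M W_star_space"
    using measurable_restrict_space1[OF proj_star_measurable, of "W_hit K"]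
    by (simp add: measurable_cong_sets[OF sQ(1) refl])
  have "W_star_hit K \<in> sets \<nu>"
    using \<nu> W_star_hit_measurable[OF K(2)] by (simp add: interlacement_intensity_def)
  then have "emeasure \<nu> (W_star_hit K) = emeasure (density \<nu> (indicator (W_star_hit K))) (W_star_hit K)"
    by (simp add: emeasure_density flip: indicator_inter_arith)
  also have "\<dots> = emeasure (distr Q W_star_space proj_star) (W_star_hit K)" by (simp add: Q)
  also have "\<dots> \<le> emeasure Q (space Q)"
    using W_star_hit_measurable[OF K(2)] meas by (simp add: emeasure_distr emeasure_space)
  also have "\<dots> < \<infinity>"
    using is_Q_finite[OF Q(1) K] by (simp add: sQ)
  finally show ?thesis .
qed

section \<open>Thinning the point process\<close>

definition vacant_avoiding ::
    "'v set \<Rightarrow> ((int \<Rightarrow> 'v) set \<times> real) point_config \<Rightarrow> real \<Rightarrow> 'v set" where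
  "vacant_avoiding K c u =
     V - \<Union>{range_star w' | w' i s. c i = Some (w', s) \<and> s \<le> u \<and> range_star w' \<inter> K = {}}"

lemma vacant_avoiding_empty [simp]: "vacant_avoiding {} c u = vacant c u"
  by (simp add: vacant_avoiding_def vacant_def)

lemma vacant_subset_avoiding: "vacant c u \<subseteq> vacant_avoiding K c u"
  by (auto simp: vacant_avoiding_def vacant_def)

lemma vacant_avoiding_subset: "vacant_avoiding K c u \<subseteq> V"
  by (auto simp: vacant_avoiding_def)

lemma mem_vacant_avoiding_iff:
  "y \<in> vacant_avoiding K c u \<longleftrightarrow> y \<in> V \<and>
    (\<forall>i w' s. c i = Some (w', s) \<longrightarrow> s \<le> u \<longrightarrow> range_star w' \<inter> K = {} \<longrightarrow> y \<notin> range_star w')"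
  unfolding vacant_avoiding_def by blast

lemma mem_vacant_iff:
  "y \<in> vacant c u \<longleftrightarrow> y \<in> V \<and> (\<forall>i w' s. c i = Some (w', s) \<longrightarrow> s \<le> u \<longrightarrow> y \<notin> range_star w')"
  using mem_vacant_avoiding_iff[of y "{}" c u] by simp

lemma vacant_avoiding_eq_vacant:
  assumes "K \<subseteq> vacant c u"
  shows "vacant_avoiding K c u = vacant c u"
proof -
  have "range_star w' \<inter> K = {}" if "c i = Some (w', s)" "s \<le> u" for w' i s
    using assms that mem_vacant_iff by blast
  then show ?thesis
    unfolding set_eq_iff mem_vacant_avoiding_iff mem_vacant_iff by blast
qed

text \<open>The points that can spoil vacancy of \<open>F\<close> at level \<open>u\<close> when only trajectories avoiding \<open>K\<close>
  count.\<close>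

definition hit_avoiding :: "'v set \<Rightarrow> 'v set \<Rightarrow> real \<Rightarrow> ((int \<Rightarrow> 'v) set \<times> real) set" where
  "hit_avoiding F K u = (W_star_hit F - W_star_hit K) \<times> {0..u}"

lemma point_count_eq_0_iff: "point_count c A = 0 \<longleftrightarrow> (\<forall>i. \<forall>p\<in>A. c i \<noteq> Some p)"
  by (auto simp: point_count_def emeasure_count_space_eq_0)

lemma subset_vacant_avoiding_iff:
  assumes c: "\<And>i p. c i = Some p \<Longrightarrow> p \<in> W_star \<times> {0..}" and F: "F \<subseteq> V"
  shows "F \<subseteq> vacant_avoiding K c u \<longleftrightarrow> point_count c (hit_avoiding F K u) = 0"
proof -
  have "F \<subseteq> vacant_avoiding K c u \<longleftrightarrow>
      (\<forall>i w' s. c i = Some (w', s) \<longrightarrow> s \<le> u \<longrightarrow> range_star w' \<inter> K = {} \<longrightarrow> range_star w' \<inter> F = {})"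
    using F unfolding subset_iff[of F] mem_vacant_avoiding_iff by blast
  also have "\<dots> \<longleftrightarrow> (\<forall>i w' s. c i = Some (w', s) \<longrightarrow> (w', s) \<notin> hit_avoiding F K u)"
  proof -
    have "(w', s) \<in> hit_avoiding F K u \<longleftrightarrow>
        s \<le> u \<and> range_star w' \<inter> K = {} \<and> range_star w' \<inter> F \<noteq> {}" if "c i = Some (w', s)" for i w' s
      using c[OF that] by (auto simp: hit_avoiding_def W_star_hit_iff)
    then show ?thesis by blast
  qed
  also have "\<dots> \<longleftrightarrow> point_count c (hit_avoiding F K u) = 0"
    by (auto simp: point_count_eq_0_iff)
  finally show ?thesis .
qed

end

section \<open>Independence and positive correlation\<close>

locale interlacement_process = weighted_graph V E a
  for V :: "'v set" and E :: "'v set set" and a :: "'v \<Rightarrow> 'v \<Rightarrow> real" +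
  fixes \<nu> :: "(int \<Rightarrow> 'v) set measure"
    and M :: "'o measure"
    and \<omega> :: "'o \<Rightarrow> ((int \<Rightarrow> 'v) set \<times> real) point_config"
  assumes intensity: "interlacement_intensity \<nu>"
    and poisson: "poisson_point_process M (\<nu> \<Otimes>\<^sub>M restrict_space lborel {0..}) \<omega>"
begin

abbreviation \<Lambda> :: "((int \<Rightarrow> 'v) set \<times> real) measure" where
  "\<Lambda> \<equiv> \<nu> \<Otimes>\<^sub>M restrict_space lborel {0..}"

sublocale prob_space M
  using poisson by (simp add: poisson_point_process_def)

lemma W_star_hit_in_sets: "K \<subseteq> V \<Longrightarrow> W_star_hit K \<in> sets \<nu>"
  using intensity W_star_hit_measurable by (simp add: interlacement_intensity_def)

lemma level_in_sets: "{0..u} \<in> sets (restrict_space lborel {0::real..})"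
  by (auto simp: sets_restrict_space_iff)

lemma hit_avoiding_in_sets: "F \<subseteq> V \<Longrightarrow> K \<subseteq> V \<Longrightarrow> hit_avoiding F K u \<in> sets \<Lambda>"
  unfolding hit_avoiding_def
  by (intro pair_measureI sets.Diff W_star_hit_in_sets level_in_sets)

lemma points_in_space:
  assumes "\<xi> \<in> space M" "\<omega> \<xi> i = Some p"
  shows "p \<in> W_star \<times> {0..}"
proof -
  have "p \<in> space \<Lambda>" using assms poisson unfolding poisson_point_process_def by blast
  then show ?thesis
    using intensity
    by (simp add: interlacement_intensity_def space_pair_measure space_restrict_space)
qed

lemma no_points_event:
  assumes "A \<in> sets \<Lambda>"
  shows "{\<xi> \<in> space M. point_count (\<omega> \<xi>) A = 0} \<in> events"
proof -
  have [measurable]: "(\<lambda>\<xi>. point_count (\<omega> \<xi>) A) \<in> borel_measurable M"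
    using poisson assms unfolding poisson_point_process_def by blast
  show ?thesis by measurable
qed

lemma no_points_indep:
  assumes A: "A \<in> sets \<Lambda>" and B: "B \<in> sets \<Lambda>" and AB: "A \<inter> B = {}"
  shows "prob ({\<xi> \<in> space M. point_count (\<omega> \<xi>) A = 0} \<inter> {\<xi> \<in> space M. point_count (\<omega> \<xi>) B = 0})
    = prob {\<xi> \<in> space M. point_count (\<omega> \<xi>) A = 0} * prob {\<xi> \<in> space M. point_count (\<omega> \<xi>) B = 0}"
proof -
  \<comment> \<open>Complete independence is given for sequences of sets, so the pair is padded with empty sets.\<close>
  define C where "C j = (if j = 0 then A else if j = 1 then B else {})" for j :: nat
  have "\<forall>j. C j \<in> sets \<Lambda>" "disjoint_family C"
    using A B AB by (auto simp: C_def disjoint_family_on_def)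
  then have "indep_vars (\<lambda>_. borel) (\<lambda>j \<xi>. point_count (\<omega> \<xi>) (C j)) UNIV"
    using poisson unfolding poisson_point_process_def by blast
  from indep_varsD[OF this, of "{0, 1}" "\<lambda>_. {0}"]
  have "prob (\<Inter>j\<in>{0, 1}. (\<lambda>\<xi>. point_count (\<omega> \<xi>) (C j)) -` {0} \<inter> space M)
      = (\<Prod>j\<in>{0, 1}. prob ((\<lambda>\<xi>. point_count (\<omega> \<xi>) (C j)) -` {0} \<inter> space M))"
    by simp
  then show ?thesis by (simp add: C_def vimage_def Int_def conj_commute conj_left_commute)
qed

lemma subset_vacant_avoiding_event_eq:
  assumes "F \<subseteq> V"
  shows "{\<xi> \<in> space M. F \<subseteq> vacant_avoiding K (\<omega> \<xi>) u}
    = {\<xi> \<in> space M. point_count (\<omega> \<xi>) (hit_avoiding F K u) = 0}"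
  by (intro Collect_cong conj_cong refl subset_vacant_avoiding_iff[OF _ assms] points_in_space)

lemma prob_vacant_pos:
  assumes K: "finite K" "K \<subseteq> V" and u: "0 \<le> u"
  shows "0 < prob {\<xi> \<in> space M. K \<subseteq> vacant (\<omega> \<xi>) u}"
proof -
  let ?A = "hit_avoiding K {} u"
  interpret level: sigma_finite_measure "restrict_space lborel {0::real..}"
    by (intro sigma_finite_measure_restrict_space) (auto intro: sigma_finite_lborel)
  have A: "?A \<in> sets \<Lambda>" using hit_avoiding_in_sets K by simp
  have "emeasure \<Lambda> ?A = emeasure \<nu> (W_star_hit K) * emeasure (restrict_space lborel {0..}) {0..u}"
    using level.emeasure_pair_measure_Times[OF W_star_hit_in_sets[OF K(2)] level_in_sets]
    by (simp add: hit_avoiding_def)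
  also have "\<dots> = emeasure \<nu> (W_star_hit K) * ennreal u"
    using u by (simp add: emeasure_restrict_space)
  also have "\<dots> < \<infinity>"
    using intensity_hit_finite[OF intensity K] by (simp add: ennreal_mult_less_top)
  finally have "prob {\<xi> \<in> space M. point_count (\<omega> \<xi>) ?A = of_nat 0}
      = measure \<Lambda> ?A ^ 0 / fact 0 * exp (- measure \<Lambda> ?A)"
    using poisson A unfolding poisson_point_process_def by blast
  then show ?thesis
    using subset_vacant_avoiding_event_eq[OF K(2), of "{}" u] by simp
qed

text \<open>Independence needs more than membership in \<open>events\<close>: the \<open>\<sigma>\<close>-algebra here is generated by
  events about trajectories avoiding \<open>K\<close> only.\<close>

lemma vacant_avoiding_event:
  assumes K: "K \<subseteq> V" and U: "U \<in> sets vertex_sets"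
  shows "{\<xi> \<in> space M. vacant_avoiding K (\<omega> \<xi>) u \<in> U} \<in> sigma_sets (space M)
    {{\<xi> \<in> space M. F \<subseteq> vacant_avoiding K (\<omega> \<xi>) u} | F. finite F \<and> F \<subseteq> V}"
proof -
  let ?X = "\<lambda>\<xi>. vacant_avoiding K (\<omega> \<xi>) u"
  have X: "?X \<in> space M \<rightarrow> Pow V" using vacant_avoiding_subset by auto
  have preimage_gen: "?X -` {T. F \<subseteq> T \<and> T \<subseteq> V} \<inter> space M = {\<xi> \<in> space M. F \<subseteq> ?X \<xi>}" for F
    using vacant_avoiding_subset by auto
  have "{?X -` A \<inter> space M | A. A \<in> vertex_sets_gen}
      = {?X -` {T. F \<subseteq> T \<and> T \<subseteq> V} \<inter> space M | F. finite F \<and> F \<subseteq> V}"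
    unfolding vertex_sets_gen_def by blast
  also have "\<dots> = {{\<xi> \<in> space M. F \<subseteq> ?X \<xi>} | F. finite F \<and> F \<subseteq> V}"
    by (simp only: preimage_gen)
  finally have gen: "{?X -` A \<inter> space M | A. A \<in> vertex_sets_gen}
      = {{\<xi> \<in> space M. F \<subseteq> ?X \<xi>} | F. finite F \<and> F \<subseteq> V}" .
  have "{\<xi> \<in> space M. ?X \<xi> \<in> U} = ?X -` U \<inter> space M" by auto
  also have "\<dots> \<in> {?X -` A \<inter> space M | A. A \<in> sigma_sets (Pow V) vertex_sets_gen}"
    using U unfolding sets_vertex_sets by blast
  finally show ?thesis unfolding sigma_sets_vimage_commute[OF X] gen .
qed

lemma subset_vacant_avoiding_event:
  assumes "F \<subseteq> V" "K \<subseteq> V"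
  shows "{\<xi> \<in> space M. F \<subseteq> vacant_avoiding K (\<omega> \<xi>) u} \<in> events"
  unfolding subset_vacant_avoiding_event_eq[OF assms(1)]
  by (intro no_points_event hit_avoiding_in_sets assms)

lemma vacant_avoiding_measurable:
  assumes K: "K \<subseteq> V" and U: "U \<in> sets vertex_sets"
  shows "{\<xi> \<in> space M. vacant_avoiding K (\<omega> \<xi>) u \<in> U} \<in> events"
proof -
  have "sigma_sets (space M)
      {{\<xi> \<in> space M. F \<subseteq> vacant_avoiding K (\<omega> \<xi>) u} | F. finite F \<and> F \<subseteq> V} \<subseteq> events"
    using subset_vacant_avoiding_event[OF _ K] by (intro sets.sigma_sets_subset) auto
  then show ?thesis using vacant_avoiding_event[OF assms] by blast
qed

text \<open>It suffices to treat the generating events \<open>F \<subseteq> \<V>\<^sub>K\<^sup>u\<close>. Such an event and the vacancy of \<open>K\<close> both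
  say that a set contains no point of the process, and the two sets are disjoint: one consists of
  trajectories avoiding \<open>K\<close>, the other of trajectories hitting \<open>K\<close>.\<close>

lemma vacant_indep_vacant_avoiding:
  assumes K: "K \<subseteq> V" and U: "U \<in> sets vertex_sets"
  shows "prob ({\<xi> \<in> space M. K \<subseteq> vacant (\<omega> \<xi>) u}
      \<inter> {\<xi> \<in> space M. vacant_avoiding K (\<omega> \<xi>) u \<in> U})
    = prob {\<xi> \<in> space M. K \<subseteq> vacant (\<omega> \<xi>) u}
      * prob {\<xi> \<in> space M. vacant_avoiding K (\<omega> \<xi>) u \<in> U}"
proof -
  let ?B = "{\<xi> \<in> space M. K \<subseteq> vacant (\<omega> \<xi>) u}"
  define G where "G F = {\<xi> \<in> space M. F \<subseteq> vacant_avoiding K (\<omega> \<xi>) u}" for F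
  let ?\<G> = "{G F | F. finite F \<and> F \<subseteq> V}"
  have B_eq: "?B = {\<xi> \<in> space M. point_count (\<omega> \<xi>) (hit_avoiding K {} u) = 0}"
    using subset_vacant_avoiding_event_eq[OF K, of "{}" u] by simp
  have "indep_set {?B} ?\<G>"
  proof (rule indep_setI)
    show "{?B} \<subseteq> events" using subset_vacant_avoiding_event[OF K, of "{}" u] by simp
    show "?\<G> \<subseteq> events" using subset_vacant_avoiding_event[OF _ K] by (auto simp: G_def)
    fix b g assume "b \<in> {?B}" "g \<in> ?\<G>"
    then obtain F where F: "F \<subseteq> V" "g = G F" and b: "b = ?B" by auto
    show "prob (b \<inter> g) = prob b * prob g"
      unfolding b F(2) G_def B_eq subset_vacant_avoiding_event_eq[OF F(1)]
    proof (rule no_points_indep)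
      show "hit_avoiding K {} u \<in> sets \<Lambda>" "hit_avoiding F K u \<in> sets \<Lambda>"
        using hit_avoiding_in_sets K F(1) by auto
    qed (auto simp: hit_avoiding_def)
  qed
  moreover have "Int_stable ?\<G>"
  proof (rule Int_stableI)
    fix g h assume "g \<in> ?\<G>" "h \<in> ?\<G>"
    then obtain F F' where "finite F" "F \<subseteq> V" "g = G F" "finite F'" "F' \<subseteq> V" "h = G F'" by auto
    then show "g \<inter> h \<in> ?\<G>"
      by (intro CollectI exI[of _ "F \<union> F'"]) (auto simp: G_def)
  qed
  ultimately have "indep_set (sigma_sets (space M) {?B}) (sigma_sets (space M) ?\<G>)"
    by (intro indep_set_sigma_sets) (auto simp: Int_stable_def)
  then show ?thesis
    by (rule indep_setD) (use vacant_avoiding_event[OF assms] in \<open>auto simp: G_def\<close>)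
qed

text \<open>On the event that \<open>K\<close> is vacant, \<open>\<V>\<^sup>u\<close> may be replaced by the independent set \<open>\<V>\<^sub>K\<^sup>u\<close>; once the
  probability is factored, replacing \<open>\<V>\<^sub>K\<^sup>u\<close> by the smaller set \<open>\<V>\<^sup>u\<close> can only decrease it.\<close>

lemma vacant_positive_correlation:
  assumes K: "K \<subseteq> V" and U: "U \<in> sets vertex_sets"
    and increasing: "\<And>S T. S \<in> U \<Longrightarrow> S \<subseteq> T \<Longrightarrow> T \<subseteq> V \<Longrightarrow> T \<in> U"
  shows "prob {\<xi> \<in> space M. K \<subseteq> vacant (\<omega> \<xi>) u} * prob {\<xi> \<in> space M. vacant (\<omega> \<xi>) u \<in> U}
    \<le> prob {\<xi> \<in> space M. K \<subseteq> vacant (\<omega> \<xi>) u \<and> vacant (\<omega> \<xi>) u \<in> U}"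
proof -
  let ?B = "{\<xi> \<in> space M. K \<subseteq> vacant (\<omega> \<xi>) u}"
  let ?U = "{\<xi> \<in> space M. vacant_avoiding K (\<omega> \<xi>) u \<in> U}"
  have "prob {\<xi> \<in> space M. vacant (\<omega> \<xi>) u \<in> U} \<le> prob ?U"
  proof (rule finite_measure_mono)
    show "{\<xi> \<in> space M. vacant (\<omega> \<xi>) u \<in> U} \<subseteq> ?U"
      using increasing[OF _ vacant_subset_avoiding vacant_avoiding_subset] by auto
  qed (rule vacant_avoiding_measurable[OF K U])
  then have "prob ?B * prob {\<xi> \<in> space M. vacant (\<omega> \<xi>) u \<in> U} \<le> prob ?B * prob ?U"
    by (simp add: mult_left_mono)
  also have "\<dots> = prob (?B \<inter> ?U)" by (rule vacant_indep_vacant_avoiding[OF K U, symmetric])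
  also have "?B \<inter> ?U = {\<xi> \<in> space M. K \<subseteq> vacant (\<omega> \<xi>) u \<and> vacant (\<omega> \<xi>) u \<in> U}"
    using vacant_avoiding_eq_vacant by auto
  finally show ?thesis .
qed

lemma percolation_zero_transfer:
  assumes x: "x \<in> V" "x' \<in> V" and u: "0 \<le> u" and zero: "\<eta> M \<omega> u x = 0"
  shows "\<eta> M \<omega> u x' = 0"
proof -
  obtain K where K: "finite K" "K \<subseteq> V" "x \<in> K" "(x, x') \<in> (open_edges K)\<^sup>*"
    using ex_finite_connecting_set[OF x] by blast
  let ?U = "\<lambda>y. {T \<in> Pow V. infinite (cluster T y)}"
  have \<eta>_eq: "\<eta> M \<omega> u y = prob {\<xi> \<in> space M. vacant (\<omega> \<xi>) u \<in> ?U y}" for y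
    using vacant_avoiding_subset[of "{}"] by (simp add: \<eta>_def)
  have "prob {\<xi> \<in> space M. K \<subseteq> vacant (\<omega> \<xi>) u} * \<eta> M \<omega> u x'
      \<le> prob {\<xi> \<in> space M. K \<subseteq> vacant (\<omega> \<xi>) u \<and> vacant (\<omega> \<xi>) u \<in> ?U x'}"
    unfolding \<eta>_eq
    by (intro vacant_positive_correlation K infinite_cluster_measurable)
      (auto dest: cluster_mono finite_subset)
  also have "\<dots> \<le> prob {\<xi> \<in> space M. vacant (\<omega> \<xi>) u \<in> ?U x}"
  proof (rule finite_measure_mono)
    show "{\<xi> \<in> space M. K \<subseteq> vacant (\<omega> \<xi>) u \<and> vacant (\<omega> \<xi>) u \<in> ?U x'}
        \<subseteq> {\<xi> \<in> space M. vacant (\<omega> \<xi>) u \<in> ?U x}"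
      using cluster_eq_of_connecting_set[OF K(3,4)] by auto
    show "{\<xi> \<in> space M. vacant (\<omega> \<xi>) u \<in> ?U x} \<in> events"
      using vacant_avoiding_measurable[of "{}", OF _ infinite_cluster_measurable] by simp
  qed
  also have "\<dots> = 0" using zero by (simp only: \<eta>_eq)
  finally have "\<eta> M \<omega> u x' \<le> 0"
    using prob_vacant_pos[OF K(1,2) u] by (simp add: mult_le_0_iff)
  moreover have "0 \<le> \<eta> M \<omega> u x'" by (simp add: \<eta>_def)
  ultimately show ?thesis by simp
qed

end

theorem corollary3p2:
  fixes V :: "'v set" and E :: "'v set set" and a :: "'v \<Rightarrow> 'v \<Rightarrow> real"
    and \<nu> :: "(int \<Rightarrow> 'v) set measure"
    and M :: "'o measure"
    and \<omega> :: "'o \<Rightarrow> ((int \<Rightarrow> 'v) set \<times> real) point_config"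
  assumes "weighted_graph V E a"
    and "weighted_graph.transient V E a"
    and "weighted_graph.interlacement_intensity V E a \<nu>"
    and "poisson_point_process M (\<nu> \<Otimes>\<^sub>M restrict_space lborel {0..}) \<omega>"
  shows "\<forall>x\<in>V. \<forall>x'\<in>V.
           weighted_graph.u_star V E M \<omega> x = weighted_graph.u_star V E M \<omega> x'"
proof (intro ballI)
  fix x x' assume x: "x \<in> V" "x' \<in> V"
  interpret interlacement_process V E a \<nu> M \<omega>
    using assms by (intro interlacement_process.intro interlacement_process_axioms.intro)
  have "{ennreal u | u. 0 \<le> u \<and> \<eta> M \<omega> u x = 0} = {ennreal u | u. 0 \<le> u \<and> \<eta> M \<omega> u x' = 0}"
    using percolation_zero_transfer x by blast
  then show "u_star M \<omega> x = u_star M \<omega> x'" by (simp add: u_star_def)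
qed

end
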